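(* Let $G$ be a group and let $A$ be an infinite subset of $G$. The following statements are equivalent: (i) $A$ is large; (ii) there exists a finite subset $F$ of $G$ such that, for each $p\in G^*$, we have $Gp=\Delta_p(FA)$; (iii) for every $p\in G^*$, there exists a finite subset $F_p$ of $G$ such that $Gp=\Delta_p(F_pA)$.
   Context: $G$ is a discrete group. $\beta G$ is the Stone-Čech compactification of $G$, whose points are the ultrafilters on $G$ (points of $G$ being identified with principal ultrafilters), with base of open sets $\overline{A}=\{p\in\beta G: A\in p\}$, $A\subseteq G$. $G^*=\beta G\setminus G$ is the set of free ultrafilters on $G$, and $A^*=\overline{A}\cap G^*$ for $A\subseteq G$. For $g\in G$ and $p\in\beta G$, $gp$ is the ultrafilter $\{B\subseteq G: g^{-1}B\in p\}$, and $Gp=\{gp:g\in G\}$. For $A\subseteq G$ and $p\in G^*$, the $p$-companion of $A$ is $\Delta_p(A)=A^*\cap Gp=\{gp: g\in G,\ A\in gp\}$. For $F\subseteq G$, $FA=\{fa:f\in F,a\in A\}$. A subset $A$ of $G$ is large if $G=FA$ for some finite subset $F$ of $G$. *)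

theory Defs
  imports "HOL-Algebra.Coset"
begin

text \<open>Ultrafilters on a carrier set \<open>X\<close>, as families of subsets of \<open>X\<close>.\<close>

definition ultrafilter_on :: "'a set \<Rightarrow> 'a set set \<Rightarrow> bool" where
  "ultrafilter_on X p \<longleftrightarrow>
     p \<subseteq> Pow X \<and> X \<in> p \<and> {} \<notin> p \<and>
     (\<forall>A\<in>p. \<forall>B\<in>p. A \<inter> B \<in> p) \<and>
     (\<forall>A\<in>p. \<forall>B. A \<subseteq> B \<and> B \<subseteq> X \<longrightarrow> B \<in> p) \<and>
     (\<forall>A. A \<subseteq> X \<longrightarrow> A \<in> p \<or> X - A \<in> p)"

definition principal_ultrafilter :: "'a set \<Rightarrow> 'a \<Rightarrow> 'a set set" where
  "principal_ultrafilter X x = {A. A \<subseteq> X \<and> x \<in> A}"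

text \<open>The point set of the Stone-Cech compactification of the discrete space \<open>X\<close>.\<close>

definition stone_cech :: "'a set \<Rightarrow> 'a set set set" where
  "stone_cech X = {p. ultrafilter_on X p}"

definition stone_cech_remainder :: "'a set \<Rightarrow> 'a set set set" where
  "stone_cech_remainder X = stone_cech X - principal_ultrafilter X ` X"

text \<open>The basic open sets \<open>{p. A \<in> p}\<close>, and their traces on the remainder.\<close>

definition stone_cech_basic :: "'a set \<Rightarrow> 'a set \<Rightarrow> 'a set set set" where
  "stone_cech_basic X A = {p \<in> stone_cech X. A \<in> p}"

definition remainder_basic :: "'a set \<Rightarrow> 'a set \<Rightarrow> 'a set set set" where
  "remainder_basic X A = stone_cech_basic X A \<inter> stone_cech_remainder X"

definition ultrafilter_translate ::
    "('a, 'b) monoid_scheme \<Rightarrow> 'a \<Rightarrow> 'a set set \<Rightarrow> 'a set set" where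
  "ultrafilter_translate G g p = {B. B \<subseteq> carrier G \<and> (inv\<^bsub>G\<^esub> g) <#\<^bsub>G\<^esub> B \<in> p}"

definition ultrafilter_orbit ::
    "('a, 'b) monoid_scheme \<Rightarrow> 'a set set \<Rightarrow> 'a set set set" where
  "ultrafilter_orbit G p = {ultrafilter_translate G g p | g. g \<in> carrier G}"

definition companion ::
    "('a, 'b) monoid_scheme \<Rightarrow> 'a set set \<Rightarrow> 'a set \<Rightarrow> 'a set set set" where
  "companion G p A = remainder_basic (carrier G) A \<inter> ultrafilter_orbit G p"

definition large :: "('a, 'b) monoid_scheme \<Rightarrow> 'a set \<Rightarrow> bool" where
  "large G A \<longleftrightarrow> (\<exists>F. finite F \<and> F \<subseteq> carrier G \<and> carrier G = F <#>\<^bsub>G\<^esub> A)"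

end

theory Submission
  imports Defs
begin

text \<open>
  If \<open>G = FA\<close>, then \<open>FA\<close> belongs to every ultrafilter on \<open>G\<close>. As left translation preserves free
  ultrafilters (\<open>ultrafilter_translate_in_remainder\<close>), the companion of \<open>FA\<close> is then the whole
  orbit, whatever the free ultrafilter is; so one \<open>F\<close> serves for all of them.

  Conversely, the sets contained in some \<open>FA\<close> with \<open>F\<close> finite form an ideal, since
  \<open>FA \<union> F'A = (F \<union> F')A\<close>. If \<open>A\<close> is not large, this ideal is proper, so some ultrafilter \<open>p\<close>
  contains the complements of all its members (\<open>not_large_imp_avoiding_ultrafilter\<close>). The ideal
  contains every singleton, because \<open>g = (g a\<^sup>-\<^sup>1) a\<close> for any \<open>a \<in> A\<close>; hence \<open>p\<close> is free. But \<open>p\<close>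
  lies in its own orbit and contains no \<open>FA\<close>, so no companion \<open>\<Delta>\<^sub>p(FA)\<close> exhausts the orbit of
  \<open>p\<close>, and the pointwise condition fails.
\<close>

section \<open>Extending filters to ultrafilters\<close>

definition proper_filter_on :: "'a set \<Rightarrow> 'a set set \<Rightarrow> bool" where
  "proper_filter_on X p \<longleftrightarrow>
     p \<subseteq> Pow X \<and> X \<in> p \<and> {} \<notin> p \<and>
     (\<forall>A\<in>p. \<forall>B\<in>p. A \<inter> B \<in> p) \<and>
     (\<forall>A\<in>p. \<forall>B. A \<subseteq> B \<and> B \<subseteq> X \<longrightarrow> B \<in> p)"

lemma ultrafilter_on_iff:
  "ultrafilter_on X p \<longleftrightarrow>
     proper_filter_on X p \<and> (\<forall>A. A \<subseteq> X \<longrightarrow> A \<in> p \<or> X - A \<in> p)"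
  unfolding ultrafilter_on_def proper_filter_on_def by blast

lemma proper_filter_onD:
  assumes "proper_filter_on X p"
  shows "p \<subseteq> Pow X" "X \<in> p" "{} \<notin> p"
    and "\<And>A B. A \<in> p \<Longrightarrow> B \<in> p \<Longrightarrow> A \<inter> B \<in> p"
    and "\<And>A B. A \<in> p \<Longrightarrow> A \<subseteq> B \<Longrightarrow> B \<subseteq> X \<Longrightarrow> B \<in> p"
  using assms by (auto simp: proper_filter_on_def)

lemma proper_filter_onI:
  assumes "p \<subseteq> Pow X" "X \<in> p" "{} \<notin> p"
    and "\<And>A B. A \<in> p \<Longrightarrow> B \<in> p \<Longrightarrow> A \<inter> B \<in> p"
    and "\<And>A B. A \<in> p \<Longrightarrow> A \<subseteq> B \<Longrightarrow> B \<subseteq> X \<Longrightarrow> B \<in> p"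
  shows "proper_filter_on X p"
  using assms by (simp add: proper_filter_on_def)

lemma proper_filter_on_Union_chain:
  assumes "C \<noteq> {}" "subset.chain {p. proper_filter_on X p} C"
  shows "proper_filter_on X (\<Union>C)"
proof -
  have filter: "proper_filter_on X p" if "p \<in> C" for p
    using assms(2) that by (auto simp: subset.chain_def)
  have comparable: "p \<subseteq> q \<or> q \<subseteq> p" if "p \<in> C" "q \<in> C" for p q
    using assms(2) that unfolding subset_chain_def by blast
  show ?thesis
  proof (rule proper_filter_onI)
    show "\<Union>C \<subseteq> Pow X" "X \<in> \<Union>C" "{} \<notin> \<Union>C"
      using proper_filter_onD(1-3)[OF filter] assms(1) by fast+
    show "B \<in> \<Union>C" if "A \<in> \<Union>C" "A \<subseteq> B" "B \<subseteq> X" for A B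
      using proper_filter_onD(5)[OF filter] that by (meson UnionE UnionI)
    fix A B assume "A \<in> \<Union>C" "B \<in> \<Union>C"
    then obtain p q where pq: "p \<in> C" "A \<in> p" "q \<in> C" "B \<in> q"
      by blast
    then obtain r where "r \<in> C" "A \<in> r" "B \<in> r"
      using comparable[of p q] by auto
    then show "A \<inter> B \<in> \<Union>C"
      using proper_filter_onD(4)[OF filter] by (meson UnionI)
  qed
qed

text \<open>A proper filter that does not contain \<open>X - B\<close> meets \<open>B\<close> in each of its members, so \<open>B\<close> can be
  adjoined to it without producing the empty set.\<close>

lemma proper_filter_on_adjoin:
  assumes p: "proper_filter_on X p" and B: "B \<subseteq> X" "X - B \<notin> p"
  shows "proper_filter_on X {C. C \<subseteq> X \<and> (\<exists>D\<in>p. D \<inter> B \<subseteq> C)}" (is "proper_filter_on X ?q")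
proof -
  note pD = proper_filter_onD[OF p]
  show ?thesis
  proof (rule proper_filter_onI)
    show "?q \<subseteq> Pow X" "X \<in> ?q"
      using pD(2) by auto
    show "{} \<notin> ?q"
    proof
      assume "{} \<in> ?q"
      then obtain D where D: "D \<in> p" "D \<inter> B = {}" by blast
      then have "D \<subseteq> X - B" using pD(1) by blast
      then have "X - B \<in> p" using pD(5)[OF D(1)] by blast
      with B show False by blast
    qed
    show "C' \<in> ?q" if "C \<in> ?q" "C \<subseteq> C'" "C' \<subseteq> X" for C C'
      using that by blast
    fix C C' assume CC: "C \<in> ?q" "C' \<in> ?q"
    then obtain D D' where D: "D \<in> p" "D \<inter> B \<subseteq> C" and D': "D' \<in> p" "D' \<inter> B \<subseteq> C'"
      by blast
    have "D \<inter> D' \<in> p" "(D \<inter> D') \<inter> B \<subseteq> C \<inter> C'"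
      using pD(4)[OF D(1) D'(1)] D(2) D'(2) by blast+
    then show "C \<inter> C' \<in> ?q"
      using CC by blast
  qed
qed

lemma proper_filter_extends_to_ultrafilter:
  assumes f: "proper_filter_on X f"
  obtains p where "ultrafilter_on X p" "f \<subseteq> p"
proof -
  let ?S = "{p. proper_filter_on X p \<and> f \<subseteq> p}"
  have chains: "\<Union>C \<in> ?S" if C: "C \<noteq> {}" "subset.chain ?S C" for C
  proof -
    have "subset.chain {p. proper_filter_on X p} C"
      using C(2) by (auto simp: subset.chain_def)
    moreover have "C \<subseteq> ?S"
      using C(2) by (simp add: subset.chain_def)
    then have "f \<subseteq> \<Union>C"
      using C(1) by fast
    ultimately show ?thesis
      using proper_filter_on_Union_chain C(1) by blast
  qed
  have "?S \<noteq> {}"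
    using f by auto
  then have "\<exists>p\<in>?S. \<forall>q\<in>?S. p \<subseteq> q \<longrightarrow> q = p"
    by (rule subset_Zorn_nonempty) (rule chains)
  then obtain p where pS: "p \<in> ?S" and maximal: "\<forall>q\<in>?S. p \<subseteq> q \<longrightarrow> q = p"
    by (rule bexE)
  have p: "proper_filter_on X p" "f \<subseteq> p"
    using pS by simp_all
  have "B \<in> p" if B: "B \<subseteq> X" "X - B \<notin> p" for B
  proof -
    let ?q = "{C. C \<subseteq> X \<and> (\<exists>D\<in>p. D \<inter> B \<subseteq> C)}"
    have "p \<subseteq> ?q" "B \<in> ?q"
      using proper_filter_onD(1,2)[OF p(1)] B(1) by auto
    have "?q \<in> ?S"
      using proper_filter_on_adjoin[OF p(1) B] order_trans[OF p(2) \<open>p \<subseteq> ?q\<close>] by simp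
    then have "p \<subseteq> ?q \<longrightarrow> ?q = p"
      by (rule bspec[OF maximal])
    then have "?q = p"
      using \<open>p \<subseteq> ?q\<close> by (rule mp)
    with \<open>B \<in> ?q\<close> show ?thesis by simp
  qed
  then have "ultrafilter_on X p"
    using p(1) unfolding ultrafilter_on_iff by blast
  with p(2) show ?thesis using that by blast
qed

section \<open>Free ultrafilters\<close>

lemma ultrafilter_with_singleton_is_principal:
  assumes p: "ultrafilter_on X p" and x: "{x} \<in> p"
  shows "p = principal_ultrafilter X x"
proof -
  have filter: "proper_filter_on X p"
    using p by (simp add: ultrafilter_on_iff)
  note pD = proper_filter_onD[OF filter]
  have "x \<in> B" if "B \<in> p" for B
  proof (rule ccontr)
    assume "x \<notin> B"
    then have "{x} \<inter> B = {}" by blast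
    then show False
      using pD(3) pD(4)[OF x that] by simp
  qed
  moreover have "B \<in> p" if "B \<subseteq> X" "x \<in> B" for B
    using pD(5)[OF x] that by simp
  ultimately show ?thesis
    using pD(1) unfolding principal_ultrafilter_def by blast
qed

lemma stone_cech_remainder_iff:
  "p \<in> stone_cech_remainder X \<longleftrightarrow> ultrafilter_on X p \<and> (\<forall>x\<in>X. {x} \<notin> p)"
  using ultrafilter_with_singleton_is_principal[of X p]
  by (auto simp: stone_cech_remainder_def stone_cech_def principal_ultrafilter_def)

section \<open>Left translation of ultrafilters\<close>

context group
begin

text \<open>Reading \<open>g\<^sup>-\<^sup>1 B\<close> as a preimage makes \<open>gp\<close> the pushforward of \<open>p\<close> under left multiplication by
  \<open>g\<close>, and preimages commute with all Boolean operations.\<close>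

lemma inv_l_coset_eq_preimage:
  assumes "g \<in> carrier G" "B \<subseteq> carrier G"
  shows "inv g <# B = {x \<in> carrier G. g \<otimes> x \<in> B}"
proof (intro equalityI subsetI)
  fix x assume "x \<in> inv g <# B"
  then obtain b where "b \<in> B" "x = inv g \<otimes> b"
    by (auto simp: l_coset_def)
  then show "x \<in> {x \<in> carrier G. g \<otimes> x \<in> B}"
    using assms by (auto simp: m_assoc[symmetric] subset_iff)
next
  fix x assume "x \<in> {x \<in> carrier G. g \<otimes> x \<in> B}"
  then have "g \<otimes> x \<in> B" "x = inv g \<otimes> (g \<otimes> x)"
    using assms by (auto simp: m_assoc[symmetric])
  then show "x \<in> inv g <# B"
    unfolding l_coset_def by blast
qed

lemma ultrafilter_translate_eq_pushforward:
  assumes "g \<in> carrier G"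
  shows "ultrafilter_translate G g p =
           {B. B \<subseteq> carrier G \<and> {x \<in> carrier G. g \<otimes> x \<in> B} \<in> p}"
  unfolding ultrafilter_translate_def
  using inv_l_coset_eq_preimage[OF assms] by auto

lemma ultrafilter_translate_in_remainder:
  assumes g: "g \<in> carrier G" and p: "p \<in> stone_cech_remainder (carrier G)"
  shows "ultrafilter_translate G g p \<in> stone_cech_remainder (carrier G)"
proof -
  let ?X = "carrier G" and ?pre = "\<lambda>B. {x \<in> carrier G. g \<otimes> x \<in> B}"
  have u: "ultrafilter_on ?X p" and free: "\<And>x. x \<in> ?X \<Longrightarrow> {x} \<notin> p"
    using p by (auto simp: stone_cech_remainder_iff)
  have filter: "proper_filter_on ?X p" and ultra: "\<And>B. B \<subseteq> ?X \<Longrightarrow> B \<in> p \<or> ?X - B \<in> p"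
    using u by (simp_all add: ultrafilter_on_iff)
  note pD = proper_filter_onD[OF filter]
  have carrier_pre: "?pre ?X = ?X" using g by auto
  have Int_pre: "?pre (B \<inter> C) = ?pre B \<inter> ?pre C" for B C by blast
  have compl_pre: "?pre (?X - B) = ?X - ?pre B" for B using g by auto
  have "proper_filter_on ?X {B. B \<subseteq> ?X \<and> ?pre B \<in> p}" (is "proper_filter_on ?X ?q")
  proof (rule proper_filter_onI)
    show "?q \<subseteq> Pow ?X" by blast
    show "?X \<in> ?q" using pD(2) carrier_pre by simp
    show "{} \<notin> ?q" using pD(3) by simp
    fix B C
    show "B \<inter> C \<in> ?q" if "B \<in> ?q" "C \<in> ?q"
      using that pD(4) Int_pre[of B C] by auto
    show "C \<in> ?q" if BC: "B \<in> ?q" "B \<subseteq> C" "C \<subseteq> ?X"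
    proof -
      have "?pre B \<subseteq> ?pre C" using BC(2) by blast
      then show ?thesis using BC pD(5)[of "?pre B" "?pre C"] by blast
    qed
  qed
  moreover have "B \<in> ?q \<or> ?X - B \<in> ?q" if "B \<subseteq> ?X" for B
  proof -
    have "?pre B \<in> p \<or> ?pre (?X - B) \<in> p"
      unfolding compl_pre by (rule ultra) blast
    then show ?thesis using that by blast
  qed
  ultimately have "ultrafilter_on ?X ?q"
    unfolding ultrafilter_on_iff by blast
  moreover have "?pre {y} \<notin> p" if y: "y \<in> ?X" for y
  proof -
    have "?pre {y} = {inv g \<otimes> y}"
      using inv_l_coset_eq_preimage[OF g, of "{y}"] y by (auto simp: l_coset_def)
    then show ?thesis using free g y by simp
  qed
  ultimately show ?thesis
    using g by (simp add: ultrafilter_translate_eq_pushforward stone_cech_remainder_iff)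
qed

lemma ultrafilter_in_own_orbit:
  assumes "ultrafilter_on (carrier G) p"
  shows "p \<in> ultrafilter_orbit G p"
proof -
  have sub: "p \<subseteq> Pow (carrier G)"
    using assms by (simp add: ultrafilter_on_def)
  have "{x \<in> carrier G. \<one> \<otimes> x \<in> B} = B" if "B \<subseteq> carrier G" for B
    using that by auto
  then have "B \<in> ultrafilter_translate G \<one> p \<longleftrightarrow> B \<in> p" for B
    using sub by (cases "B \<subseteq> carrier G") (auto simp: ultrafilter_translate_eq_pushforward)
  then have "p = ultrafilter_translate G \<one> p"
    by blast
  then show ?thesis
    unfolding ultrafilter_orbit_def using one_closed by blast
qed

lemma companion_carrier_eq_orbit:
  assumes p: "p \<in> stone_cech_remainder (carrier G)"
  shows "companion G p (carrier G) = ultrafilter_orbit G p"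
proof -
  have "q \<in> remainder_basic (carrier G) (carrier G)" if "q \<in> ultrafilter_orbit G p" for q
  proof -
    have "q \<in> stone_cech_remainder (carrier G)"
      using that p ultrafilter_translate_in_remainder by (auto simp: ultrafilter_orbit_def)
    then show ?thesis
      by (auto simp: remainder_basic_def stone_cech_basic_def stone_cech_remainder_def
          stone_cech_def ultrafilter_on_def)
  qed
  then show ?thesis
    unfolding companion_def by blast
qed

section \<open>Subsets that are not large\<close>

text \<open>The ultrafilter extends the filter dual to the ideal of sets covered by finitely many
  translates of \<open>A\<close>; non-largeness says that this ideal is proper, and non-emptiness of \<open>A\<close> puts all
  singletons into it.\<close>

lemma not_large_imp_avoiding_ultrafilter:
  assumes A: "A \<subseteq> carrier G" "A \<noteq> {}" and "\<not> large G A"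
  obtains p where "p \<in> stone_cech_remainder (carrier G)"
    "\<And>F. finite F \<Longrightarrow> F \<subseteq> carrier G \<Longrightarrow> F <#> A \<notin> p"
proof -
  let ?X = "carrier G"
  let ?f = "{B. B \<subseteq> ?X \<and> (\<exists>F. finite F \<and> F \<subseteq> ?X \<and> ?X - B \<subseteq> F <#> A)}"
  have closed: "F <#> A \<subseteq> ?X" if "F \<subseteq> ?X" for F
    using that A(1) by (rule set_mult_closed)
  have "{} \<notin> ?f"
  proof
    assume "{} \<in> ?f"
    then obtain F where "finite F" "F \<subseteq> ?X" "?X \<subseteq> F <#> A" by auto
    then have "large G A"
      using closed unfolding large_def by blast
    with assms(3) show False by blast
  qed
  moreover have "?X \<in> ?f"
    by auto
  moreover have "B \<inter> C \<in> ?f" if BC: "B \<in> ?f" "C \<in> ?f" for B C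
  proof -
    obtain F F' where F: "finite F" "F \<subseteq> ?X" "?X - B \<subseteq> F <#> A"
      and F': "finite F'" "F' \<subseteq> ?X" "?X - C \<subseteq> F' <#> A"
      using BC by blast
    have "(F \<union> F') <#> A = (F <#> A) \<union> (F' <#> A)"
      unfolding set_mult_def by blast
    then have "?X - (B \<inter> C) \<subseteq> (F \<union> F') <#> A" "finite (F \<union> F')" "F \<union> F' \<subseteq> ?X"
      using F F' by blast+
    moreover have "B \<inter> C \<subseteq> ?X"
      using BC by blast
    ultimately show ?thesis
      by (intro CollectI conjI exI[of _ "F \<union> F'"])
  qed
  moreover have "C \<in> ?f" if BC: "B \<in> ?f" "B \<subseteq> C" "C \<subseteq> ?X" for B C
  proof -
    obtain F where F: "finite F" "F \<subseteq> ?X" "?X - B \<subseteq> F <#> A"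
      using BC(1) by blast
    then have "?X - C \<subseteq> F <#> A"
      using BC(2) by blast
    then show ?thesis using F BC(3) by blast
  qed
  ultimately have "proper_filter_on ?X ?f"
    by (intro proper_filter_onI) (assumption | rule subsetI, blast)+
  then obtain p where p: "ultrafilter_on ?X p" "?f \<subseteq> p"
    by (rule proper_filter_extends_to_ultrafilter)
  then have filter: "proper_filter_on ?X p"
    by (simp add: ultrafilter_on_iff)
  have avoid: "F <#> A \<notin> p" if F: "finite F" "F \<subseteq> ?X" for F
  proof
    assume FA: "F <#> A \<in> p"
    have "?X - (?X - (F <#> A)) \<subseteq> F <#> A" by blast
    then have "?X - (F <#> A) \<in> ?f" using F by blast
    then have "?X - (F <#> A) \<in> p" using p(2) by blast
    then have "(F <#> A) \<inter> (?X - (F <#> A)) \<in> p"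
      using proper_filter_onD(4)[OF filter FA] by blast
    moreover have "(F <#> A) \<inter> (?X - (F <#> A)) = {}" by blast
    ultimately show False
      using proper_filter_onD(3)[OF filter] by simp
  qed
  have "{x} \<notin> p" if x: "x \<in> ?X" for x
  proof
    assume "{x} \<in> p"
    obtain a where a: "a \<in> A" using A(2) by blast
    then have aX: "a \<in> ?X" using A(1) by blast
    let ?F = "{x \<otimes> inv a}"
    have F: "?F \<subseteq> ?X" using x aX by simp
    have "x = (x \<otimes> inv a) \<otimes> a" using x aX by (simp add: m_assoc)
    then have "{x} \<subseteq> ?F <#> A" using a unfolding set_mult_def by blast
    then have "?F <#> A \<in> p"
      using proper_filter_onD(5)[OF filter \<open>{x} \<in> p\<close>] closed[OF F] by blast
    then show False using avoid[of ?F] F by blast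
  qed
  with p(1) have "p \<in> stone_cech_remainder ?X"
    by (simp add: stone_cech_remainder_iff)
  then show ?thesis using that avoid by blast
qed

end

section \<open>Largeness and companions\<close>

theorem proposition2:
  fixes G :: "('a, 'b) monoid_scheme" and A :: "'a set"
  assumes "group G" and "A \<subseteq> carrier G" and "infinite A"
  shows "(large G A \<longleftrightarrow>
          (\<exists>F. finite F \<and> F \<subseteq> carrier G \<and>
            (\<forall>p \<in> stone_cech_remainder (carrier G).
              ultrafilter_orbit G p = companion G p (F <#>\<^bsub>G\<^esub> A)))) \<and>
         ((\<exists>F. finite F \<and> F \<subseteq> carrier G \<and>
            (\<forall>p \<in> stone_cech_remainder (carrier G).
              ultrafilter_orbit G p = companion G p (F <#>\<^bsub>G\<^esub> A))) \<longleftrightarrow>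
          (\<forall>p \<in> stone_cech_remainder (carrier G).
            \<exists>F. finite F \<and> F \<subseteq> carrier G \<and>
              ultrafilter_orbit G p = companion G p (F <#>\<^bsub>G\<^esub> A)))"
proof -
  interpret group G by fact
  let ?R = "stone_cech_remainder (carrier G)"
  let ?exhausts = "\<lambda>p F. ultrafilter_orbit G p = companion G p (F <#>\<^bsub>G\<^esub> A)"
  let ?uniform = "\<exists>F. finite F \<and> F \<subseteq> carrier G \<and> (\<forall>p\<in>?R. ?exhausts p F)"
  let ?pointwise = "\<forall>p\<in>?R. \<exists>F. finite F \<and> F \<subseteq> carrier G \<and> ?exhausts p F"
  have large_uniform: "?uniform" if large: "large G A"
  proof -
    obtain F where F: "finite F" "F \<subseteq> carrier G" "F <#>\<^bsub>G\<^esub> A = carrier G"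
      using large unfolding large_def by auto
    have "\<forall>p\<in>?R. ?exhausts p F"
      unfolding F(3) using companion_carrier_eq_orbit by simp
    with F(1,2) show ?thesis by blast
  qed
  have uniform_pointwise: "?pointwise" if "?uniform"
    using that by blast
  have pointwise_large: "large G A" if pw: "?pointwise"
  proof (rule ccontr)
    assume "\<not> large G A"
    moreover have "A \<noteq> {}" using assms(3) by auto
    ultimately obtain p where p: "p \<in> ?R"
      and avoid: "\<And>F. finite F \<Longrightarrow> F \<subseteq> carrier G \<Longrightarrow> F <#>\<^bsub>G\<^esub> A \<notin> p"
      using not_large_imp_avoiding_ultrafilter[OF assms(2)] by blast
    obtain F where F: "finite F" "F \<subseteq> carrier G" "?exhausts p F"
      using pw p by blast
    have "p \<in> ultrafilter_orbit G p"
      using p by (intro ultrafilter_in_own_orbit) (simp add: stone_cech_remainder_iff)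
    then have "p \<in> companion G p (F <#>\<^bsub>G\<^esub> A)"
      unfolding F(3) .
    then have "F <#>\<^bsub>G\<^esub> A \<in> p"
      by (simp add: companion_def remainder_basic_def stone_cech_basic_def)
    with avoid F(1,2) show False by blast
  qed
  show ?thesis
    using large_uniform uniform_pointwise pointwise_large by argo
qed

end
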